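(* Let $n,p$ be positive integers with $p\le n$, let $A\in\mathbb{R}^{2n\times 2n}$ be symmetric positive definite with symplectic eigenvalues $0<d_1\le\dots\le d_n$. For any $\beta>d_p$, the problem $$\min_{X\in\mathbb{R}^{2n\times 2p}} f_\beta(X):=\tfrac12\operatorname{tr}(X^\top AX)+\tfrac{\beta}{4}\|X^\top J_nX-J_p\|_F^2$$ has no local minimizers other than global minimizers. Specifically, each first-order stationary point of $f_\beta$ (i.e. each $X$ with $\nabla f_\beta(X)=0$) is either a global minimizer, a saddle point, or a local maximizer.
   Context: For a positive integer $k$, $J_k=\begin{bmatrix}0&I_k\\-I_k&0\end{bmatrix}\in\mathbb{R}^{2k\times 2k}$. By Williamson's theorem, for symmetric positive definite $A\in\mathbb{R}^{2n\times 2n}$ there is $S\in\mathbb{R}^{2n\times 2n}$ with $S^\top J_nS=J_n$ and $S^\top AS=\mathrm{Diag}(d_1,\dots,d_n,d_1,\dots,d_n)$, $d_j>0$; the $d_j$ are uniquely determined up to order and are the symplectic eigenvalues of $A$. A saddle point is a stationary point that is neither a local minimizer nor a local maximizer. *)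

theory Defs
  imports "HOL-Analysis.Analysis"
begin

text \<open>
  The index type \<open>'k + 'k\<close> splits \<open>2k\<close> coordinates into two blocks of size \<open>k = CARD('k)\<close>
  (\<open>Inl\<close>: first block, \<open>Inr\<close>: second block). A real \<open>2n \<times> 2p\<close> matrix thus has type
  \<open>real^('p + 'p)^('n + 'n)\<close>, the row index being the outer one.
\<close>

definition symplectic_J :: "real^('k + 'k)^('k::finite + 'k)" where
  "symplectic_J = (\<chi> i j. case (i, j) of
      (Inl a, Inr b) \<Rightarrow> (if a = b then 1 else 0)
    | (Inr a, Inl b) \<Rightarrow> (if a = b then - 1 else 0)
    | _ \<Rightarrow> 0)"

definition sym_pos_def :: "real^'m^'m::finite \<Rightarrow> bool" where
  "sym_pos_def A \<longleftrightarrow> transpose A = A \<and> (\<forall>x. x \<noteq> 0 \<longrightarrow> x \<bullet> (A *v x) > 0)"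

definition double_diag :: "('k \<Rightarrow> real) \<Rightarrow> real^('k + 'k)^('k::finite + 'k)" where
  "double_diag e = (\<chi> i j. if i = j then (case i of Inl a \<Rightarrow> e a | Inr a \<Rightarrow> e a) else 0)"

text \<open>
  \<open>d 1 \<le> \<dots> \<le> d n\<close> is the ordered list of symplectic eigenvalues of \<open>A\<close>, read off from a
  Williamson diagonal form of \<open>A\<close>. As the index type \<open>'n\<close> carries no order, \<open>\<nu>\<close> numbers its
  elements by \<open>1, \<dots>, n\<close>. Only the values of \<open>d\<close> on \<open>{1..n}\<close> matter.
\<close>

definition symplectic_eigenvalues ::
  "real^('n + 'n)^('n::finite + 'n) \<Rightarrow> (nat \<Rightarrow> real) \<Rightarrow> bool" where
  "symplectic_eigenvalues A d \<longleftrightarrow>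
     (\<forall>j\<in>{1..CARD('n)}. 0 < d j) \<and> mono_on {1..CARD('n)} d \<and>
     (\<exists>S \<nu>. bij_betw \<nu> (UNIV :: 'n set) {1..CARD('n)} \<and>
        transpose S ** symplectic_J ** S = symplectic_J \<and>
        transpose S ** A ** S = double_diag (\<lambda>a. d (\<nu> a)))"

text \<open>The norm of \<open>real^'a^'b\<close> is the Frobenius norm:\<close>

lemma norm_matrix_eq_Frobenius:
  fixes M :: "real^'a^'b"
  shows "norm M = sqrt (\<Sum>i\<in>UNIV. \<Sum>j\<in>UNIV. (M $ i $ j)\<^sup>2)"
  by (simp add: norm_vec_def L2_set_def sum_nonneg)

definition penalty_fun ::
  "real^('n + 'n)^('n::finite + 'n) \<Rightarrow> real \<Rightarrow> real^('p::finite + 'p)^('n + 'n) \<Rightarrow> real" where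
  "penalty_fun A \<beta> X =
     1 / 2 * trace (transpose X ** A ** X) +
     \<beta> / 4 * (norm (transpose X ** symplectic_J ** X - symplectic_J))\<^sup>2"

definition global_minimizer :: "('a \<Rightarrow> real) \<Rightarrow> 'a \<Rightarrow> bool" where
  "global_minimizer f x \<longleftrightarrow> (\<forall>y. f x \<le> f y)"

definition local_minimizer :: "('a::topological_space \<Rightarrow> real) \<Rightarrow> 'a \<Rightarrow> bool" where
  "local_minimizer f x \<longleftrightarrow> (\<forall>\<^sub>F y in nhds x. f x \<le> f y)"

definition local_maximizer :: "('a::topological_space \<Rightarrow> real) \<Rightarrow> 'a \<Rightarrow> bool" where
  "local_maximizer f x \<longleftrightarrow> (\<forall>\<^sub>F y in nhds x. f y \<le> f x)"

text \<open>The gradient is taken with respect to the inner product; on matrices this is the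
  Frobenius (trace) inner product.\<close>

definition stationary_point :: "('a::real_inner \<Rightarrow> real) \<Rightarrow> 'a \<Rightarrow> bool" where
  "stationary_point f x \<longleftrightarrow> (GDERIV f x :> 0)"

definition saddle_point :: "('a::real_inner \<Rightarrow> real) \<Rightarrow> 'a \<Rightarrow> bool" where
  "saddle_point f x \<longleftrightarrow>
     stationary_point f x \<and> \<not> local_minimizer f x \<and> \<not> local_maximizer f x"

end

theory Submission
  imports Defs
begin

text \<open>
  Only the claim that every local minimiser is global needs work: a stationary point that is neither
  a local minimiser nor a local maximiser is a saddle point by definition.

  The substitution \<open>X = S Y\<close> with the symplectic \<open>S\<close> of a Williamson form is a linear homeomorphism
  that leaves \<open>X\<^sup>T J X\<close> unchanged, so \<open>A\<close> may be assumed to be \<open>D = double_diag e\<close>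
  (\<open>penalty_fun_symplectic\<close>). At a critical point of the penalty function, \<open>X\<close> then commutes with \<open>J\<close>,
  i.e. it is a complex matrix of size \<open>n \<times> p\<close> in disguise, and \<open>X X\<^sup>T X = R X\<close> for the diagonal matrix
  \<open>R = 1 - D / \<beta>\<close> with entries \<open>r\<^sub>i\<close> (\<open>critical_point_structure\<close>). So each row of \<open>X\<close> is an eigenvector of the
  Gram matrix \<open>T = X\<^sup>T X\<close>, and the value there is \<open>\<beta>/4 * (2p - norm T ^ 2)\<close>
  (\<open>penalty_fun_critical_value\<close>).

  Describe such an \<open>X\<close> by the weights \<open>s\<^sub>i\<close>, the squared length of row \<open>i\<close> divided by \<open>r\<^sub>i\<close>.
  They lie in \<open>[0, 1]\<close>, their sum is at most \<open>2p\<close> (it is the trace of the projection onto the row space), and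
  \<open>norm T ^ 2\<close> equals \<open>\<Sum> s\<^sub>i r\<^sub>i\<^sup>2\<close>. Minimising among critical points is therefore bounded by a fractional
  knapsack problem, whose optimum fills the rows with \<open>r\<^sub>i\<close> above a threshold \<open>\<theta>\<close> (\<open>s\<^sub>i = 1\<close>) and leaves those below it
  empty (\<open>s\<^sub>i = 0\<close>) (\<open>gram_norm_optimal\<close>).

  A local minimiser has this greedy form. Let \<open>v\<close> be an eigenvector of \<open>T\<close> with eigenvalue \<open>\<theta>\<close>, taken in the
  kernel of \<open>X\<close> if there is one and otherwise as a nonzero row with smallest \<open>r\<^sub>k\<close>. If some row \<open>i\<close> with
  \<open>r\<^sub>i > \<theta>\<close> is not full, there is a vector \<open>u\<close> with \<open>X\<^sup>T u = 0\<close> and \<open>R u = r\<^sub>i u\<close>, and moving along the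
  \<open>J\<close>-commuting version of \<open>u v\<^sup>T\<close> changes the penalty function by a positive multiple of \<open>\<theta> - r\<^sub>i\<close>
  to second order, a descent (\<open>local_minimizer_row_weight_full\<close>). Finally, a global minimiser exists by coercivity and is itself a
  critical point, so a local minimiser does at least as well as it.
\<close>

section \<open>Matrix algebra\<close>

abbreviation J :: "real^('k + 'k)^('k::finite + 'k)" where
  "J \<equiv> symplectic_J"

definition diag :: "('m \<Rightarrow> real) \<Rightarrow> real^'m^'m::finite" where
  "diag r = (\<chi> i j. if i = j then r i else 0)"

lemma matrix_add_rdistrib: "(A + B) ** C = A ** C + B ** (C :: real^'c^'b::finite)"
  by (simp add: vec_eq_iff matrix_matrix_mult_def sum.distrib algebra_simps)

lemma matrix_minus_left: "(- A) ** B = - (A ** (B :: real^'c^'b::finite))"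
  by (simp add: vec_eq_iff matrix_matrix_mult_def sum_negf)

lemma matrix_minus_right: "A ** (- B) = - (A ** (B :: real^'c^'b::finite))"
  by (simp add: vec_eq_iff matrix_matrix_mult_def sum_negf)

lemma matrix_scale_left: "(k *\<^sub>R A) ** B = k *\<^sub>R (A ** (B :: real^'c^'b::finite))"
  by (simp add: vec_eq_iff matrix_matrix_mult_def sum_distrib_left algebra_simps)

lemma matrix_scale_right: "A ** (k *\<^sub>R B) = k *\<^sub>R (A ** (B :: real^'c^'b::finite))"
  by (simp add: vec_eq_iff matrix_matrix_mult_def sum_distrib_left algebra_simps)

lemma matrix_diff_ldistrib: "A ** (B - C) = A ** B - A ** (C :: real^'c^'b::finite)"
  by (simp add: vec_eq_iff matrix_matrix_mult_def sum_subtractf algebra_simps)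

lemma matrix_diff_rdistrib: "(A - B) ** C = A ** C - B ** (C :: real^'c^'b::finite)"
  by (simp add: vec_eq_iff matrix_matrix_mult_def sum_subtractf algebra_simps)

lemmas matrix_expand =
  matrix_add_ldistrib matrix_add_rdistrib matrix_diff_ldistrib matrix_diff_rdistrib
  matrix_minus_left matrix_minus_right matrix_scale_left matrix_scale_right
  matrix_mul_assoc[symmetric]

lemma transpose_add: "transpose (A + B) = transpose A + transpose (B :: real^'a^'b)"
  by (simp add: vec_eq_iff transpose_def)

lemma transpose_diff: "transpose (A - B) = transpose A - transpose (B :: real^'a^'b)"
  by (simp add: vec_eq_iff transpose_def)

lemma transpose_minus: "transpose (- A) = - transpose (A :: real^'a^'b)"
  by (simp add: vec_eq_iff transpose_def)

lemmas transpose_expand = transpose_add transpose_diff transpose_minus transpose_scalar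
  matrix_transpose_mul

text \<open>
  The inner product on matrices is the Frobenius one, so multiplication by a matrix has multiplication by its
  transpose as adjoint. This replaces all manipulations of traces below.
\<close>

lemma inner_matrix_mult_left:
  fixes A :: "real^'b::finite^'a::finite" and X :: "real^'c::finite^'b"
  shows "(A ** X) \<bullet> Y = X \<bullet> (transpose A ** Y)"
proof -
  have "(A ** X) \<bullet> Y = (\<Sum>i\<in>UNIV. \<Sum>j\<in>UNIV. \<Sum>k\<in>UNIV. A$i$k * X$k$j * Y$i$j)"
    by (simp add: inner_vec_def matrix_matrix_mult_def sum_distrib_right)
  also have "\<dots> = (\<Sum>i\<in>UNIV. \<Sum>k\<in>UNIV. \<Sum>j\<in>UNIV. A$i$k * X$k$j * Y$i$j)"
    by (rule sum.cong[OF refl], rule sum.swap)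
  also have "\<dots> = (\<Sum>k\<in>UNIV. \<Sum>i\<in>UNIV. \<Sum>j\<in>UNIV. A$i$k * X$k$j * Y$i$j)"
    by (rule sum.swap)
  also have "\<dots> = (\<Sum>k\<in>UNIV. \<Sum>j\<in>UNIV. \<Sum>i\<in>UNIV. A$i$k * X$k$j * Y$i$j)"
    by (rule sum.cong[OF refl], rule sum.swap)
  also have "\<dots> = X \<bullet> (transpose A ** Y)"
    by (simp add: inner_vec_def matrix_matrix_mult_def transpose_def sum_distrib_left ac_simps)
  finally show ?thesis .
qed

lemma inner_transpose: "transpose X \<bullet> transpose Y = X \<bullet> (Y :: real^'a::finite^'b::finite)"
  by (simp add: inner_vec_def transpose_def) (rule sum.swap)

lemma inner_matrix_mult_right:
  fixes B :: "real^'c::finite^'b::finite" and X :: "real^'b^'a::finite"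
  shows "(X ** B) \<bullet> Y = X \<bullet> (Y ** transpose B)"
proof -
  have "(X ** B) \<bullet> Y = (transpose B ** transpose X) \<bullet> transpose Y"
    by (metis inner_transpose matrix_transpose_mul)
  also have "\<dots> = transpose X \<bullet> transpose (Y ** transpose B)"
    by (simp add: inner_matrix_mult_left matrix_transpose_mul)
  finally show ?thesis by (simp add: inner_transpose)
qed

lemma trace_transpose_mult: "trace (transpose X ** Y) = X \<bullet> (Y :: real^'a::finite^'b::finite)"
  by (simp add: trace_def matrix_matrix_mult_def transpose_def inner_vec_def) (rule sum.swap)

lemma inner_mat_1: "mat 1 \<bullet> (mat 1 :: real^'a::finite^'a) = real CARD('a)"
  using trace_transpose_mult[of "mat 1" "mat 1 :: real^'a^'a"] by (simp add: trace_I)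

lemma sum_UNIV_sum:
  "(\<Sum>i\<in>(UNIV :: ('a::finite + 'b::finite) set). g i) = (\<Sum>a\<in>UNIV. g (Inl a)) + (\<Sum>b\<in>UNIV. (g (Inr b) :: 'c::comm_monoid_add))"
  by (simp flip: UNIV_Plus_UNIV add: sum.Plus)

section \<open>The symplectic form and Williamson coordinates\<close>

lemma transpose_J: "transpose J = - J"
  by (auto simp: vec_eq_iff transpose_def symplectic_J_def split: sum.split)

lemma J_J: "J ** J = - (mat 1 :: real^('k + 'k)^('k::finite + 'k))"
proof -
  have "(J ** J) $ i $ j = (- (mat 1 :: real^('k + 'k)^('k + 'k))) $ i $ j" for i j :: "'k + 'k"
    by (cases i; cases j)
       (simp_all add: matrix_matrix_mult_def sum_UNIV_sum symplectic_J_def mat_def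
          if_distrib[of "\<lambda>x. x * _"] cong: if_cong)
  then show ?thesis by (simp add: vec_eq_iff)
qed

lemma J_J_mult: "J ** (J ** X) = - (X :: real^'c^('k::finite + 'k))"
  by (simp add: matrix_mul_assoc J_J matrix_minus_left)

lemma diag_mult: "diag r ** X = (\<chi> i. r i *\<^sub>R (X $ i))" for X :: "real^'c^'m::finite"
  by (simp add: vec_eq_iff matrix_matrix_mult_def diag_def if_distrib[of "\<lambda>x. x * _"] cong: if_cong)

lemma mult_diag: "X ** diag r = (\<chi> i j. X $ i $ j * r j)" for X :: "real^'m::finite^'c"
  by (simp add: vec_eq_iff matrix_matrix_mult_def diag_def if_distrib[of "\<lambda>x. _ * x"] cong: if_cong)

lemma transpose_diag: "transpose (diag r) = diag r"
  by (auto simp: vec_eq_iff transpose_def diag_def)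

text \<open>
The matrices commute because the two diagonal blocks agree.
\<close>

lemma J_diag: "J ** diag (case_sum e e) = diag (case_sum e e) ** J"
  by (auto simp: vec_eq_iff mult_diag diag_mult symplectic_J_def split: sum.split)

lemma double_diag_eq: "double_diag e = diag (case_sum e e)"
  by (auto simp: vec_eq_iff diag_def double_diag_def split: sum.split)

lemma penalty_fun_eq:
  "penalty_fun A \<beta> X = 1/2 * (X \<bullet> (A ** X)) + \<beta>/4 * (norm (transpose X ** J ** X - J))\<^sup>2"
  by (simp add: penalty_fun_def trace_transpose_mult flip: matrix_mul_assoc)

lemma penalty_fun_symplectic:
  assumes "transpose S ** J ** S = J"
  shows "penalty_fun A \<beta> (S ** Y) = penalty_fun (transpose S ** A ** S) \<beta> Y"
proof -
  have "transpose Y ** (transpose S ** (J ** (S ** Y))) = transpose Y ** (J ** Y)"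
    using assms by (metis matrix_mul_assoc)
  then show ?thesis
    by (simp add: penalty_fun_def matrix_transpose_mul flip: matrix_mul_assoc)
qed

lemma symplectic_has_inverse:
  fixes S :: "real^('k + 'k)^('k::finite + 'k)"
  assumes "transpose S ** J ** S = J"
  obtains S' where "S ** S' = mat 1" "S' ** S = mat 1"
proof -
  let ?S' = "- (J ** transpose S ** J)"
  have "?S' ** S = - (J ** (transpose S ** J ** S))"
    by (simp add: matrix_expand)
  also have "\<dots> = mat 1" by (simp add: assms J_J)
  finally have "?S' ** S = mat 1" .
  then show ?thesis using that[of ?S'] matrix_left_right_inverse by blast
qed

section \<open>Continuity and first-order conditions\<close>

lemma bounded_bilinear_matrix_mult:
  "bounded_bilinear ((**) :: real^'b::finite^'a::finite \<Rightarrow> real^'c::finite^'b \<Rightarrow> _)"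
  unfolding bilinear_conv_bounded_bilinear[symmetric] bilinear_def linear_iff
  by (simp add: matrix_expand)

lemma continuous_on_matrix_mult [continuous_intros]:
  fixes f :: "'t::topological_space \<Rightarrow> real^'b::finite^'a::finite" and g :: "'t \<Rightarrow> real^'c::finite^'b"
  shows "continuous_on U f \<Longrightarrow> continuous_on U g \<Longrightarrow> continuous_on U (\<lambda>x. f x ** g x)"
  by (rule bounded_bilinear.continuous_on[OF bounded_bilinear_matrix_mult])

lemma continuous_on_transpose [continuous_intros]:
  fixes f :: "'t::topological_space \<Rightarrow> real^'b::finite^'a::finite"
  shows "continuous_on U f \<Longrightarrow> continuous_on U (\<lambda>x. transpose (f x))"
  unfolding transpose_def by (intro continuous_intros)

lemma continuous_on_penalty_fun: "continuous_on U (penalty_fun A \<beta>)"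
  unfolding penalty_fun_eq[abs_def] by (intro continuous_intros)

text \<open>
  Along a line the penalty function is a quartic polynomial, so its first-order condition can be
  read off from the linear coefficient.
\<close>

lemma quartic_local_min_imp_linear_coeff_zero:
  fixes a b c e :: real
  assumes "\<forall>\<^sub>F s in nhds 0. 0 \<le> a * s + b * s\<^sup>2 + c * s ^ 3 + e * s ^ 4"
  shows "a = 0"
proof -
  obtain \<delta> where "\<delta> > 0" and nonneg: "\<And>s. \<bar>s\<bar> < \<delta> \<Longrightarrow> 0 \<le> a * s + b * s\<^sup>2 + c * s ^ 3 + e * s ^ 4"
    using assms by (auto simp: eventually_nhds_metric dist_real_def)
  have "DERIV (\<lambda>s. a * s + b * s\<^sup>2 + c * s ^ 3 + e * s ^ 4) 0 :> a"
    by (auto intro!: derivative_eq_intros)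
  then show ?thesis
    by (rule DERIV_local_min[OF _ \<open>\<delta> > 0\<close>]) (simp add: nonneg)
qed

lemma norm_add_scaled_pair_square:
  fixes P L Q :: "'a::real_inner"
  shows "(norm (P + s *\<^sub>R L + s\<^sup>2 *\<^sub>R Q))\<^sup>2 =
    (norm P)\<^sup>2 + 2 * s * (P \<bullet> L) + s\<^sup>2 * ((norm L)\<^sup>2 + 2 * (P \<bullet> Q)) + s ^ 3 * (2 * (L \<bullet> Q)) + s ^ 4 * (norm Q)\<^sup>2"
  unfolding power2_norm_eq_inner
  by (simp add: inner_add_left inner_add_right inner_commute[of L P] inner_commute[of Q P]
      inner_commute[of Q L] algebra_simps power2_eq_square power3_eq_cube power4_eq_xxxx)

text \<open>
  The linear coefficient identifies \<open>A X - \<beta> J X (W - J)\<close> as the gradient at \<open>X\<close>. The two first-order terms of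
  \<open>X\<^sup>T J X\<close> contribute equally because \<open>W - J\<close> is skew-symmetric.
\<close>

lemma penalty_fun_on_line:
  fixes A :: "real^('n::finite + 'n)^('n + 'n)" and X H :: "real^('p::finite + 'p)^('n + 'n)"
  assumes "transpose A = A"
  defines "W \<equiv> transpose X ** J ** X"
  obtains b c e where "\<And>s. penalty_fun A \<beta> (X + s *\<^sub>R H) = penalty_fun A \<beta> X
    + (H \<bullet> (A ** X - \<beta> *\<^sub>R (J ** X ** (W - J)))) * s + b * s\<^sup>2 + c * s ^ 3 + e * s ^ 4"
proof -
  define L where "L = transpose H ** J ** X + transpose X ** J ** H"
  define Q where "Q = transpose H ** J ** H"
  have exp: "transpose (X + s *\<^sub>R H) ** J ** (X + s *\<^sub>R H) - J = (W - J) + s *\<^sub>R L + s\<^sup>2 *\<^sub>R Q" for s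
    by (simp add: W_def L_def Q_def transpose_expand matrix_expand scaleR_add_right power2_eq_square)
  have skew: "transpose (W - J) = - (W - J)"
    by (simp add: W_def transpose_expand transpose_J matrix_expand)
  have half: "(W - J) \<bullet> (transpose X ** J ** H) = - (H \<bullet> (J ** X ** (W - J)))"
  proof -
    have "(W - J) \<bullet> (transpose X ** J ** H) = (X ** (W - J)) \<bullet> (J ** H)"
      by (simp add: inner_matrix_mult_left matrix_mul_assoc)
    also have "\<dots> = H \<bullet> (transpose J ** (X ** (W - J)))"
      by (simp add: inner_matrix_mult_left inner_commute)
    finally show ?thesis
      by (simp add: transpose_J matrix_minus_left matrix_mul_assoc)
  qed
  have "(W - J) \<bullet> (transpose H ** J ** X) = (W - J) \<bullet> (transpose X ** J ** H)"
  proof -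
    have "transpose (transpose H ** J ** X) = - (transpose X ** J ** H)"
      by (simp add: transpose_expand transpose_J matrix_expand)
    then have "(W - J) \<bullet> (transpose H ** J ** X) = (- (W - J)) \<bullet> (- (transpose X ** J ** H))"
      using inner_transpose[of "W - J" "transpose H ** J ** X"] skew by simp
    then show ?thesis by (simp only: inner_minus_left inner_minus_right minus_minus)
  qed
  then have lin: "(W - J) \<bullet> L = - 2 * (H \<bullet> (J ** X ** (W - J)))"
    using half by (simp add: L_def inner_add_right)
  have quad: "(X + s *\<^sub>R H) \<bullet> (A ** (X + s *\<^sub>R H)) =
      X \<bullet> (A ** X) + 2 * s * (H \<bullet> (A ** X)) + s\<^sup>2 * (H \<bullet> (A ** H))" for s
  proof -
    have "X \<bullet> (A ** H) = H \<bullet> (A ** X)"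
      using assms(1) inner_matrix_mult_left[of A H X] by (simp add: inner_commute)
    then show ?thesis
      by (simp add: matrix_expand inner_add_left inner_add_right algebra_simps power2_eq_square)
  qed
  show ?thesis
  proof (rule that)
    fix s
    show "penalty_fun A \<beta> (X + s *\<^sub>R H) = penalty_fun A \<beta> X
      + (H \<bullet> (A ** X - \<beta> *\<^sub>R (J ** X ** (W - J)))) * s
      + ((H \<bullet> (A ** H)) / 2 + \<beta>/4 * ((norm L)\<^sup>2 + 2 * ((W - J) \<bullet> Q))) * s\<^sup>2
      + (\<beta>/4 * (2 * (L \<bullet> Q))) * s ^ 3 + (\<beta>/4 * (norm Q)\<^sup>2) * s ^ 4"
      unfolding penalty_fun_eq exp quad norm_add_scaled_pair_square lin
      by (simp add: W_def[symmetric] inner_diff_right field_simps)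
  qed
qed

lemma local_minimizer_on_line:
  fixes X H :: "'a::real_normed_vector"
  assumes "local_minimizer f X"
  shows "\<forall>\<^sub>F s in nhds 0. f X \<le> f (X + s *\<^sub>R H)"
proof -
  have "((\<lambda>s::real. X + s *\<^sub>R H) \<longlongrightarrow> X + 0 *\<^sub>R H) (nhds 0)"
    by (intro tendsto_intros filterlim_ident)
  then show ?thesis
    using assms unfolding local_minimizer_def by (auto simp: filterlim_iff)
qed

lemma local_minimizer_imp_critical:
  fixes A :: "real^('n::finite + 'n)^('n + 'n)" and X :: "real^('p::finite + 'p)^('n + 'n)"
  assumes "transpose A = A" and "local_minimizer (penalty_fun A \<beta>) X"
  shows "A ** X = \<beta> *\<^sub>R (J ** X ** (transpose X ** J ** X - J))"
proof -
  define H where "H = A ** X - \<beta> *\<^sub>R (J ** X ** (transpose X ** J ** X - J))"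
  obtain b c e where line: "\<And>s. penalty_fun A \<beta> (X + s *\<^sub>R H) =
      penalty_fun A \<beta> X + (H \<bullet> H) * s + b * s\<^sup>2 + c * s ^ 3 + e * s ^ 4"
    using penalty_fun_on_line[OF assms(1), of \<beta> X H] unfolding H_def by blast
  have "H \<bullet> H = 0"
    using local_minimizer_on_line[OF assms(2), of H] unfolding line
    by (intro quartic_local_min_imp_linear_coeff_zero[of _ b c e]) (simp add: add.assoc)
  then show ?thesis by (simp add: H_def)
qed

section \<open>Critical points in Williamson coordinates\<close>

lemma inner_diag_mult:
  fixes X :: "real^'c::finite^'m::finite"
  shows "X \<bullet> (diag r ** X) = (\<Sum>i\<in>UNIV. r i * (norm (X $ i))\<^sup>2)"
  by (simp add: inner_vec_def[of X] diag_mult power2_norm_eq_inner)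

lemma diag_definite:
  fixes Y :: "real^'c::finite^'m::finite"
  assumes "\<And>i. e i > 0" and "Y \<bullet> (diag e ** Y) \<le> 0"
  shows "Y = 0"
proof -
  have nonneg: "e i * (norm (Y $ i))\<^sup>2 \<ge> 0" for i
    using assms(1)[of i] by simp
  then have "(\<Sum>i\<in>UNIV. e i * (norm (Y $ i))\<^sup>2) = 0"
    using assms(2) by (intro antisym sum_nonneg) (simp_all add: inner_diag_mult)
  then have "e i * (norm (Y $ i))\<^sup>2 = 0" for i
    using nonneg by (simp add: sum_nonneg_eq_0_iff)
  then show ?thesis
    using assms(1) less_imp_neq[OF assms(1)] by (simp add: vec_eq_iff[of Y] eq_commute[of 0])
qed

text \<open>
  If \<open>e a\<close> is the symplectic eigenvalue attached to row \<open>a\<close>, then \<open>1 - e a / \<beta>\<close> is the squared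
  length that a minimiser gives to that row whenever it uses the row fully.
\<close>

definition row_target :: "real \<Rightarrow> ('n \<Rightarrow> real) \<Rightarrow> 'n + 'n \<Rightarrow> real" where
  "row_target \<beta> e i = 1 - case_sum e e i / \<beta>"

text \<open>
  Write \<open>W = X\<^sup>T J X\<close> and \<open>M = - J W\<close>, and let \<open>D\<close> be the diagonal matrix.
  Multiplying the critical point equation by \<open>X\<^sup>T\<close> gives \<open>X\<^sup>T D X = \<beta> (W\<^sup>2 - W J)\<close>, and symmetry of the left
  side forces \<open>W J = J W\<close>; hence \<open>M\<close> is symmetric and \<open>X\<^sup>T D X = \<beta> (M - M\<^sup>2)\<close>. Consequently
  \<open>G = \<beta> (1 - M)\<close> satisfies \<open>\<beta> G = \<beta> X\<^sup>T D X + G\<^sup>2\<close>, so it is positive semidefinite. The equation itself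
  reads \<open>D X = - J X J G\<close>, so that \<open>D\<^sup>2 X = X G\<^sup>2\<close>. Taking square roots (\<open>D\<close> is positive definite
  and \<open>G\<close> positive semidefinite) yields \<open>D X = X G\<close>, and comparing the two expressions for \<open>D X\<close>
  yields \<open>J X = X J\<close>. Then \<open>M = X\<^sup>T X\<close>, and \<open>D X = X G\<close> becomes the second claim.
\<close>

lemma critical_point_structure:
  fixes X :: "real^('p::finite + 'p)^('n::finite + 'n)" and e :: "'n \<Rightarrow> real"
  assumes e: "\<And>a. e a > 0" and \<beta>: "\<beta> > 0"
    and crit: "double_diag e ** X = \<beta> *\<^sub>R (J ** X ** (transpose X ** J ** X - J))"
  shows "J ** X = X ** J"
    and "X ** transpose X ** X = diag (row_target \<beta> e) ** X"
proof -
  define W where "W = transpose X ** J ** X"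
  define M where "M = - (J ** W)"
  define G where "G = \<beta> *\<^sub>R (mat 1 - M)"
  define D where "D = diag (case_sum e e)"
  have pos: "case_sum e e i > 0" for i
    using e by (cases i) auto
  have W_eq: "W = J ** M"
    by (simp add: M_def matrix_expand J_J_mult)
  have W_skew: "transpose W = - W"
    by (simp add: W_def transpose_expand transpose_J matrix_expand)
  have D_sym: "transpose D = D"
    by (simp add: D_def transpose_diag)
  have JD: "J ** D = D ** J"
    by (simp add: D_def J_diag)
  have DX: "D ** X = \<beta> *\<^sub>R (J ** X ** (W - J))"
    using crit by (simp add: W_def D_def double_diag_eq)
  have XDX: "transpose X ** D ** X = \<beta> *\<^sub>R (W ** W - W ** J)"
  proof -
    have "transpose X ** D ** X = transpose X ** (D ** X)" by (simp add: matrix_mul_assoc)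
    also have "\<dots> = \<beta> *\<^sub>R (W ** (W - J))"
      unfolding DX by (simp add: W_def matrix_expand)
    finally show ?thesis by (simp add: matrix_expand)
  qed
  have WJ: "W ** J = J ** W"
  proof -
    have "transpose (transpose X ** D ** X) = transpose X ** D ** X"
      by (simp add: transpose_expand D_sym matrix_expand)
    then have "\<beta> *\<^sub>R (J ** W) = \<beta> *\<^sub>R (W ** J)"
      unfolding XDX by (simp add: transpose_expand W_skew transpose_J matrix_expand scaleR_diff_right)
    then show ?thesis using \<beta> by simp
  qed
  have MJ: "M ** J = J ** M"
    by (simp add: M_def matrix_expand WJ)
  have M_sym: "transpose M = M"
    by (simp add: M_def transpose_expand W_skew transpose_J matrix_expand WJ)
  have G_sym: "transpose G = G"
    by (simp add: G_def transpose_expand M_sym)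
  have GJ: "G ** J = J ** G"
    by (simp add: G_def matrix_expand MJ)
  have JMJ: "J ** M ** J = - M"
    by (simp add: matrix_expand MJ J_J_mult)
  have JMJM: "W ** W = - (M ** M)"
  proof -
    have "W ** W = (J ** M ** J) ** M" by (simp only: W_eq matrix_mul_assoc)
    then show ?thesis by (simp only: JMJ matrix_minus_left)
  qed
  have S: "transpose X ** D ** X = \<beta> *\<^sub>R (M - M ** M)"
    unfolding XDX JMJM WJ by (simp add: M_def)
  have G_psd: "(Y ** G) \<bullet> Y \<ge> 0" for Y :: "real^('p + 'p)^('n + 'n)"
  proof -
    have "\<beta> *\<^sub>R G = \<beta> *\<^sub>R (transpose X ** D ** X) + G ** G"
      unfolding S by (simp add: G_def matrix_expand algebra_simps)
    then have "(Y ** (\<beta> *\<^sub>R G)) \<bullet> Y = (Y ** (\<beta> *\<^sub>R (transpose X ** D ** X) + G ** G)) \<bullet> Y"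
      by simp
    then have "\<beta> * ((Y ** G) \<bullet> Y) = \<beta> * ((Y ** (transpose X ** D ** X)) \<bullet> Y) + (Y ** (G ** G)) \<bullet> Y"
      by (simp only: inner_add_left inner_scaleR_left matrix_add_ldistrib matrix_scale_right)
    moreover have "(Y ** (G ** G)) \<bullet> Y \<ge> 0"
    proof -
      have "(Y ** (G ** G)) \<bullet> Y = (Y ** G) \<bullet> (Y ** G)"
        by (simp add: matrix_mul_assoc inner_matrix_mult_right[of "Y ** G"] G_sym)
      then show ?thesis by simp
    qed
    moreover have "(Y ** (transpose X ** D ** X)) \<bullet> Y \<ge> 0"
    proof -
      have "(Y ** (transpose X ** D ** X)) \<bullet> Y = (Y ** transpose X ** D) \<bullet> (Y ** transpose X)"
        by (simp add: matrix_mul_assoc inner_matrix_mult_right[of "Y ** transpose X ** D"])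
      also have "\<dots> = (X ** transpose Y) \<bullet> (D ** (X ** transpose Y))"
        using inner_transpose[of "Y ** transpose X ** D" "Y ** transpose X"]
        by (simp add: transpose_expand D_sym inner_commute)
      also have "\<dots> \<ge> 0"
        unfolding D_def inner_diag_mult using pos by (intro sum_nonneg) (simp add: less_imp_le)
      finally show ?thesis .
    qed
    ultimately have "\<beta> * ((Y ** G) \<bullet> Y) \<ge> 0" using \<beta> by simp
    then show ?thesis using \<beta> by (simp add: zero_le_mult_iff)
  qed
  have DX': "D ** X = - (J ** X ** J ** G)"
    unfolding DX by (simp add: W_eq G_def matrix_expand scaleR_diff_right)
  have "D ** (D ** X) = - (J ** (D ** X) ** J ** G)"
  proof -
    have "D ** (D ** X) = - (D ** J ** X ** J ** G)"
      by (subst DX') (simp add: matrix_expand)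
    then show ?thesis by (simp add: JD[symmetric] matrix_expand)
  qed
  also have "\<dots> = - (X ** (J ** G) ** (J ** G))"
    unfolding DX' by (simp add: matrix_expand J_J_mult)
  also have "\<dots> = X ** G ** G"
  proof -
    have "(J ** G) ** (J ** G) = J ** (G ** J) ** G" by (simp only: matrix_mul_assoc)
    also have "\<dots> = - (G ** G)" by (simp only: GJ J_J_mult matrix_minus_left)
    finally have "X ** ((J ** G) ** (J ** G)) = - (X ** (G ** G))"
      by (simp only: matrix_minus_right)
    then show ?thesis by (simp only: matrix_mul_assoc minus_minus)
  qed
  finally have DDX: "D ** (D ** X) = X ** G ** G" .
  define Y where "Y = D ** X - X ** G"
  have "D ** Y + Y ** G = 0"
    by (simp add: Y_def matrix_expand DDX)
  then have "Y \<bullet> (D ** Y + Y ** G) = 0"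
    by simp
  then have "Y \<bullet> (D ** Y) + (Y ** G) \<bullet> Y = 0"
    by (simp only: inner_add_right inner_commute[of "Y ** G"])
  then have "Y \<bullet> (D ** Y) \<le> 0"
    using G_psd[of Y] by simp
  then have "Y = 0"
    unfolding D_def using diag_definite[of "case_sum e e" Y] pos by blast
  then have XG: "D ** X = X ** G"
    by (simp add: Y_def)
  have "D ** (J ** X - X ** J) = 0"
  proof -
    have "D ** (J ** X) = J ** (D ** X)" by (simp add: matrix_mul_assoc JD)
    also have "\<dots> = X ** J ** G" unfolding DX' by (simp add: matrix_expand J_J_mult)
    also have "\<dots> = X ** G ** J" by (simp only: matrix_mul_assoc[symmetric] GJ)
    also have "\<dots> = D ** (X ** J)" by (simp only: XG[symmetric] matrix_mul_assoc)
    finally show ?thesis by (simp add: matrix_expand)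
  qed
  then have "J ** X - X ** J = 0"
    using diag_definite[of "case_sum e e" "J ** X - X ** J"] pos by (simp add: D_def)
  then show JX: "J ** X = X ** J" by simp
  have "J ** transpose X = transpose X ** J"
    using arg_cong[OF JX, of transpose] by (simp add: transpose_expand transpose_J matrix_expand)
  then have "M = transpose X ** X"
    by (simp add: M_def W_def matrix_mul_assoc) (simp add: matrix_expand J_J_mult)
  then have "D ** X = \<beta> *\<^sub>R (X - X ** transpose X ** X)"
    using XG by (simp add: G_def matrix_expand)
  then have "X ** transpose X ** X = X - (1/\<beta>) *\<^sub>R (D ** X)"
    using \<beta> by simp
  also have "\<dots> = diag (row_target \<beta> e) ** X"
    by (simp add: D_def row_target_def diag_mult vec_eq_iff algebra_simps)
  finally show "X ** transpose X ** X = diag (row_target \<beta> e) ** X" .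
qed

section \<open>Matrices whose rows are eigenvectors of their Gram matrix\<close>

lemma matrix_mult_row: "(A ** B) $ i = A $ i v* B" for A :: "real^'b::finite^'a"
  by (simp add: vec_eq_iff matrix_matrix_mult_def vector_matrix_mult_def mult.commute)

lemma gram_entry: "(X ** transpose X) $ i $ j = X $ i \<bullet> X $ j" for X :: "real^'c::finite^'m::finite"
  by (simp add: matrix_matrix_mult_def transpose_def inner_vec_def)

text \<open>
  A row with \<open>r i = 0\<close> vanishes in all cases of interest, and division by zero then gives the right
  value \<open>0\<close>; the same convention turns \<open>diag (\<lambda>i. 1 / r i)\<close> into a pseudo-inverse of \<open>diag r\<close>.
\<close>

definition row_weight :: "('m \<Rightarrow> real) \<Rightarrow> real^'c::finite^'m::finite \<Rightarrow> 'm \<Rightarrow> real" where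
  "row_weight r X i = (norm (X $ i))\<^sup>2 / r i"

text \<open>
  Under the hypothesis \<open>X X\<^sup>T X = diag r X\<close> this is the orthogonal projection onto the row space of \<open>X\<close>.
\<close>

definition row_projection :: "('m \<Rightarrow> real) \<Rightarrow> real^'c::finite^'m::finite \<Rightarrow> real^'c^'c" where
  "row_projection r X = transpose X ** diag (\<lambda>i. 1 / r i) ** X"

context
  fixes X :: "real^'c::finite^'m::finite" and r :: "'m \<Rightarrow> real"
  assumes crit: "X ** transpose X ** X = diag r ** X"
begin

lemma row_eigenvector: "X $ i v* (transpose X ** X) = r i *\<^sub>R X $ i"
proof -
  have "(X ** (transpose X ** X)) $ i = (diag r ** X) $ i"
    using crit by (simp add: matrix_mul_assoc)
  then show ?thesis by (simp add: matrix_mult_row[of X] diag_mult)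
qed

lemma gram_square: "(X ** transpose X) ** (X ** transpose X) = diag r ** (X ** transpose X)"
  by (simp only: matrix_mul_assoc crit)

text \<open>
  \<open>X X\<^sup>T\<close> commutes with \<open>diag r\<close> because its square is both symmetric and equal to \<open>diag r (X X\<^sup>T)\<close>.
  Hence rows with different \<open>r\<close> are orthogonal.
\<close>

lemma gram_commutes: "r i * (X $ i \<bullet> X $ j) = r j * (X $ i \<bullet> X $ j)"
proof -
  have "diag r ** (X ** transpose X) = (X ** transpose X) ** diag r"
  proof -
    have "transpose (diag r ** (X ** transpose X)) = diag r ** (X ** transpose X)"
      unfolding gram_square[symmetric] by (simp add: matrix_transpose_mul)
    then show ?thesis by (simp add: matrix_transpose_mul transpose_diag)
  qed
  then have "(diag r ** (X ** transpose X)) $ i $ j = ((X ** transpose X) ** diag r) $ i $ j"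
    by simp
  then show ?thesis by (simp add: diag_mult mult_diag gram_entry mult.commute)
qed

text \<open>
  A diagonal entry of \<open>(X X\<^sup>T)\<^sup>2\<close> is a sum of squares that includes the square of the diagonal entry of \<open>X X\<^sup>T\<close>.
\<close>

lemma row_norm_bound: "(norm (X $ i))\<^sup>2 * (norm (X $ i))\<^sup>2 \<le> r i * (norm (X $ i))\<^sup>2"
proof -
  have "(X $ i \<bullet> X $ i) * (X $ i \<bullet> X $ i) \<le> (\<Sum>j\<in>UNIV. (X $ i \<bullet> X $ j) * (X $ i \<bullet> X $ j))"
    by (rule member_le_sum) auto
  also have "\<dots> = ((X ** transpose X) ** (X ** transpose X)) $ i $ i"
    by (simp add: matrix_matrix_mult_def[of "X ** transpose X"] gram_entry inner_commute)
  also have "\<dots> = r i * (X $ i \<bullet> X $ i)"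
    unfolding gram_square by (simp add: diag_mult gram_entry)
  finally show ?thesis by (simp add: power2_norm_eq_inner)
qed

lemma row_zero_if_nonpos: "r i \<le> 0 \<Longrightarrow> X $ i = 0"
proof (rule ccontr)
  assume "r i \<le> 0" "X $ i \<noteq> 0"
  then have "0 < (norm (X $ i))\<^sup>2 * (norm (X $ i))\<^sup>2" "r i * (norm (X $ i))\<^sup>2 \<le> 0"
    by (simp_all add: mult_nonpos_nonneg)
  then show False using row_norm_bound[of i] by linarith
qed

lemma row_weight_times: "row_weight r X i * r i = (norm (X $ i))\<^sup>2"
  using row_zero_if_nonpos[of i] by (cases "r i = 0") (auto simp: row_weight_def)

lemma row_weight_eq_0: "r i \<le> 0 \<Longrightarrow> row_weight r X i = 0"
  by (simp add: row_weight_def row_zero_if_nonpos)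

lemma row_weight_nonneg: "0 \<le> row_weight r X i"
  using row_weight_eq_0[of i] by (cases "r i \<le> 0") (auto simp: row_weight_def)

lemma row_weight_le_1: "row_weight r X i \<le> 1"
proof (cases "r i \<le> 0 \<or> X $ i = 0")
  case True
  then show ?thesis using row_weight_eq_0[of i] by (auto simp: row_weight_def)
next
  case False
  then have "(norm (X $ i))\<^sup>2 \<le> r i"
    by (intro mult_right_le_imp_le[OF row_norm_bound]) simp
  then show ?thesis using False by (simp add: row_weight_def)
qed

lemma norm_gram_square: "(norm (transpose X ** X))\<^sup>2 = (\<Sum>i\<in>UNIV. row_weight r X i * (r i)\<^sup>2)"
proof -
  have "(norm (transpose X ** X))\<^sup>2 = X \<bullet> (X ** transpose X ** X)"
    by (simp add: power2_norm_eq_inner inner_matrix_mult_left matrix_mul_assoc)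
  also have "\<dots> = (\<Sum>i\<in>UNIV. r i * (norm (X $ i))\<^sup>2)"
    unfolding crit inner_diag_mult ..
  also have "\<dots> = (\<Sum>i\<in>UNIV. row_weight r X i * (r i)\<^sup>2)"
    by (simp only: row_weight_times[symmetric]) (simp add: power2_eq_square mult_ac)
  finally show ?thesis .
qed

lemma row_projection_fixes: "X ** row_projection r X = X"
proof -
  have "(X ** transpose X) ** diag (\<lambda>i. 1 / r i) = diag (\<lambda>i. 1 / r i) ** (X ** transpose X)"
  proof -
    have "(X $ i \<bullet> X $ j) * (1 / r j) = (1 / r i) * (X $ i \<bullet> X $ j)" for i j
      using gram_commutes[of i j] by (cases "X $ i \<bullet> X $ j = 0") auto
    then show ?thesis by (simp add: vec_eq_iff mult_diag diag_mult gram_entry)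
  qed
  then have "X ** row_projection r X = diag (\<lambda>i. 1 / r i) ** (X ** transpose X ** X)"
    by (simp only: row_projection_def matrix_mul_assoc)
  also have "\<dots> = X"
    unfolding crit using row_zero_if_nonpos by (auto simp: vec_eq_iff[of _ X] diag_mult)
  finally show ?thesis .
qed

text \<open>
  The weights sum to the trace of the row projection \<open>P\<close>, whose defect from full rank is the squared
  Frobenius norm of the complementary projection \<open>1 - P\<close>. The row space is everything if and only if
  the sum attains the number of columns.
\<close>

lemma sum_row_weight:
  "(\<Sum>i\<in>UNIV. row_weight r X i) = real CARD('c) - (norm (mat 1 - row_projection r X))\<^sup>2"
proof -
  let ?P = "row_projection r X"
  have idem: "?P ** ?P = ?P"
  proof -
    have "?P ** ?P = transpose X ** diag (\<lambda>i. 1 / r i) ** (X ** ?P)"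
      by (simp only: row_projection_def matrix_mul_assoc)
    also have "\<dots> = ?P"
      by (simp only: row_projection_fixes) (simp only: row_projection_def)
    finally show ?thesis .
  qed
  have sym: "transpose ?P = ?P"
    by (simp add: row_projection_def transpose_expand transpose_diag matrix_mul_assoc)
  have "?P \<bullet> ?P = mat 1 \<bullet> ?P"
    using inner_matrix_mult_right[of "mat 1" ?P ?P] by (simp add: sym idem)
  then have "(norm (mat 1 - ?P))\<^sup>2 = real CARD('c) - mat 1 \<bullet> ?P"
    by (simp add: power2_norm_eq_inner inner_diff_left inner_diff_right inner_mat_1 inner_commute)
  moreover have "mat 1 \<bullet> ?P = X \<bullet> (diag (\<lambda>i. 1 / r i) ** X)"
    using inner_matrix_mult_left[of X "mat 1" "diag (\<lambda>i. 1 / r i) ** X"]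
    by (simp add: row_projection_def matrix_mul_assoc)
  ultimately show ?thesis
    by (simp add: inner_diag_mult row_weight_def)
qed

end

text \<open>
  Optimality of the greedy solution of the knapsack problem that maximises \<open>\<Sum> s\<^sub>i r\<^sub>i\<^sup>2\<close>: \<open>\<theta>\<^sup>2\<close> is the multiplier of
  the constraint on \<open>\<Sum> s\<^sub>i\<close>, and \<open>slack\<close> is complementary slackness. Once \<open>\<theta>\<^sup>2 \<Sum> s\<^sub>i\<close> is split off, \<open>X\<close> is optimal in each
  summand separately.
\<close>

lemma gram_norm_optimal:
  fixes X Z :: "real^'c::finite^'m::finite"
  assumes X: "X ** transpose X ** X = diag r ** X" and Z: "Z ** transpose Z ** Z = diag r ** Z"
    and "\<theta> \<ge> 0"
    and full: "\<And>i. r i > \<theta> \<Longrightarrow> row_weight r X i = 1"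
    and empty: "\<And>i. r i < \<theta> \<Longrightarrow> row_weight r X i = 0"
    and slack: "\<theta> = 0 \<or> (\<Sum>i\<in>UNIV. row_weight r X i) = real CARD('c)"
  shows "norm (transpose Z ** Z) \<le> norm (transpose X ** X)"
proof -
  let ?x = "row_weight r X" and ?z = "row_weight r Z"
  have term_le: "?z i * ((r i)\<^sup>2 - \<theta>\<^sup>2) \<le> ?x i * ((r i)\<^sup>2 - \<theta>\<^sup>2)" for i
  proof -
    consider "r i > \<theta>" | "r i = \<theta>" | "0 < r i" "r i < \<theta>" | "r i \<le> 0" by linarith
    then show ?thesis
    proof cases
      case 1
      then have "(r i)\<^sup>2 - \<theta>\<^sup>2 \<ge> 0" using \<open>\<theta> \<ge> 0\<close> by (simp add: power_mono)
      then show ?thesis using full[OF 1] mult_right_mono[OF row_weight_le_1[OF Z, of i]] by simp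
    next
      case 3
      then have "(r i)\<^sup>2 - \<theta>\<^sup>2 \<le> 0" by (simp add: power_mono)
      then show ?thesis using empty[OF 3(2)] row_weight_nonneg[OF Z, of i] by (simp add: mult_nonneg_nonpos)
    next
      case 4
      then show ?thesis by (simp add: row_weight_eq_0[OF X] row_weight_eq_0[OF Z])
    qed simp
  qed
  have split: "(\<Sum>i\<in>UNIV. w i * (r i)\<^sup>2) = (\<Sum>i\<in>UNIV. w i * ((r i)\<^sup>2 - \<theta>\<^sup>2)) + \<theta>\<^sup>2 * (\<Sum>i\<in>UNIV. w i)" for w :: "'m \<Rightarrow> real"
    unfolding sum_distrib_left sum.distrib[symmetric] by (simp add: algebra_simps)
  have "\<theta>\<^sup>2 * (\<Sum>i\<in>UNIV. ?z i) \<le> \<theta>\<^sup>2 * (\<Sum>i\<in>UNIV. ?x i)"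
  proof (cases "\<theta> = 0")
    case False
    then show ?thesis using slack sum_row_weight[OF Z] by (intro mult_left_mono) simp_all
  qed simp
  moreover have "(\<Sum>i\<in>UNIV. ?z i * ((r i)\<^sup>2 - \<theta>\<^sup>2)) \<le> (\<Sum>i\<in>UNIV. ?x i * ((r i)\<^sup>2 - \<theta>\<^sup>2))"
    by (intro sum_mono term_le)
  ultimately have "(norm (transpose Z ** Z))\<^sup>2 \<le> (norm (transpose X ** X))\<^sup>2"
    unfolding norm_gram_square[OF X] norm_gram_square[OF Z] split[of ?x] split[of ?z] by linarith
  then show ?thesis by (rule power2_le_imp_le) simp
qed

section \<open>Second-order conditions\<close>

definition outer :: "real^'m \<Rightarrow> real^'c \<Rightarrow> real^'c^'m" where
  "outer u v = (\<chi> i j. u $ i * v $ j)"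

lemma matrix_mult_outer: "B ** outer u v = outer (B *v u) v"
  by (simp add: vec_eq_iff outer_def matrix_matrix_mult_def matrix_vector_mult_def sum_distrib_right mult.assoc)

lemma outer_matrix_mult: "outer u v ** B = outer u (v v* B)"
  by (simp add: vec_eq_iff outer_def matrix_matrix_mult_def vector_matrix_mult_def sum_distrib_left ac_simps)

lemma outer_mult_vec: "outer u v *v w = (v \<bullet> w) *\<^sub>R u"
  by (simp add: vec_eq_iff outer_def matrix_vector_mult_def inner_vec_def sum_distrib_right sum_distrib_left ac_simps)

lemma outer_scale: "outer (k *\<^sub>R u) v = k *\<^sub>R outer u v" "outer u (k *\<^sub>R v) = k *\<^sub>R outer u v"
  by (simp_all add: vec_eq_iff outer_def)

lemma outer_zero: "outer 0 v = 0"
  by (simp add: vec_eq_iff outer_def)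

lemma J_isotropic: "v \<bullet> (J *v v) = 0"
proof -
  have "v \<bullet> (J *v v) = (transpose J *v v) \<bullet> v"
    by (simp add: dot_lmul_matrix)
  also have "\<dots> = - ((J *v v) \<bullet> v)"
    unfolding transpose_J by (simp add: matrix_vector_mult_def inner_vec_def sum_negf)
  finally show ?thesis by (simp add: inner_commute)
qed

text \<open>
  For such \<open>X\<close>, \<open>X\<^sup>T J X - J\<close> is \<open>X\<^sup>T X - 1\<close> followed by the orthogonal matrix \<open>J\<close>.
\<close>

lemma penalty_fun_commuting:
  fixes X :: "real^('p::finite + 'p)^('n::finite + 'n)"
  assumes "J ** X = X ** J"
  shows "penalty_fun A \<beta> X = 1/2 * (X \<bullet> (A ** X)) + \<beta>/4 * (norm (transpose X ** X - mat 1))\<^sup>2"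
proof -
  let ?B = "transpose X ** X - mat 1"
  have "transpose X ** J ** X = transpose X ** (J ** X)" by (simp add: matrix_mul_assoc)
  then have "transpose X ** J ** X - J = ?B ** J"
    unfolding assms by (simp add: matrix_expand)
  moreover have "(?B ** J) \<bullet> (?B ** J) = ?B \<bullet> ?B"
  proof -
    have "(?B ** J) ** transpose J = ?B"
      by (simp add: transpose_J J_J matrix_minus_right flip: matrix_mul_assoc)
    then show ?thesis by (simp only: inner_matrix_mult_right)
  qed
  ultimately show ?thesis by (simp add: penalty_fun_eq power2_norm_eq_inner)
qed

lemma penalty_fun_critical_value:
  fixes X :: "real^('p::finite + 'p)^('n::finite + 'n)"
  assumes "\<beta> \<noteq> 0" and JX: "J ** X = X ** J"
    and crit: "X ** transpose X ** X = diag (row_target \<beta> e) ** X"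
  shows "penalty_fun (double_diag e) \<beta> X
    = \<beta>/4 * (real CARD('p + 'p) - (norm (transpose X ** X))\<^sup>2)"
proof -
  let ?T = "transpose X ** X"
  have "double_diag e ** X = \<beta> *\<^sub>R (X - X ** transpose X ** X)"
    unfolding crit double_diag_eq using \<open>\<beta> \<noteq> 0\<close>
    by (simp add: row_target_def diag_mult vec_eq_iff algebra_simps)
  then have "X \<bullet> (double_diag e ** X) = \<beta> * (X \<bullet> X - X \<bullet> (X ** ?T))"
    by (simp add: matrix_mul_assoc inner_diff_right)
  moreover have "X \<bullet> X = ?T \<bullet> mat 1"
    using inner_matrix_mult_left[of X "mat 1" X] by (simp add: inner_commute)
  moreover have "X \<bullet> (X ** ?T) = ?T \<bullet> ?T"
    using inner_matrix_mult_left[of X ?T X] by (simp add: inner_commute)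
  ultimately show ?thesis
    unfolding penalty_fun_commuting[OF JX]
    by (simp add: power2_norm_eq_inner inner_diff_left inner_diff_right inner_mat_1 inner_commute algebra_simps)
qed

text \<open>
  The first-order and third-order terms vanish because the columns of \<open>X\<close> and \<open>H\<close> are orthogonal
  and \<open>D H\<close> is a multiple of \<open>H\<close>. In the second-order term,
  \<open>D H = \<beta> (1 - \<rho>) H\<close> contributes \<open>1 - \<rho>\<close> and \<open>T - 1\<close> contributes \<open>\<theta> - 1\<close>.
\<close>

lemma penalty_fun_along_eigendirection:
  fixes X H :: "real^('p::finite + 'p)^('n::finite + 'n)"
  assumes "\<beta> \<noteq> 0" and JX: "J ** X = X ** J" and JH: "J ** H = H ** J"
    and XH: "transpose X ** H = 0"
    and RH: "diag (row_target \<beta> e) ** H = \<rho> *\<^sub>R H"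
    and HT: "H ** (transpose X ** X) = \<theta> *\<^sub>R H"
  shows "penalty_fun (double_diag e) \<beta> (X + s *\<^sub>R H) = penalty_fun (double_diag e) \<beta> X
    + s\<^sup>2 * (\<beta>/2 * (\<theta> - \<rho>) * (norm H)\<^sup>2) + s ^ 4 * (\<beta>/4 * (norm (transpose H ** H))\<^sup>2)"
proof -
  let ?D = "double_diag e" and ?T = "transpose X ** X" and ?Q = "transpose H ** H"
  have HX: "transpose H ** X = 0"
    using arg_cong[OF XH, of transpose] by (simp add: matrix_transpose_mul) (simp add: vec_eq_iff transpose_def)
  have comm: "J ** (X + s *\<^sub>R H) = (X + s *\<^sub>R H) ** J"
    by (simp add: matrix_expand JX JH)
  have DH: "?D ** H = (\<beta> * (1 - \<rho>)) *\<^sub>R H"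
  proof -
    have "?D ** H = \<beta> *\<^sub>R (H - diag (row_target \<beta> e) ** H)"
      using \<open>\<beta> \<noteq> 0\<close> by (simp add: double_diag_eq row_target_def diag_mult vec_eq_iff algebra_simps)
    then show ?thesis unfolding RH by (simp add: algebra_simps)
  qed
  have XH0: "X \<bullet> H = 0"
    using inner_matrix_mult_left[of X "mat 1" H] XH by simp
  have sym: "transpose ?D = ?D" by (simp add: double_diag_eq transpose_diag)
  have "H \<bullet> (?D ** X) = (?D ** H) \<bullet> X"
    by (simp add: inner_matrix_mult_left sym)
  then have HDX: "H \<bullet> (?D ** X) = 0"
    unfolding DH by (simp add: inner_commute[of H X] XH0)
  have quad: "(X + s *\<^sub>R H) \<bullet> (?D ** (X + s *\<^sub>R H)) = X \<bullet> (?D ** X) + s\<^sup>2 * (\<beta> * (1 - \<rho>) * (H \<bullet> H))"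
    by (simp add: matrix_expand DH HDX XH0 inner_add_left inner_add_right power2_eq_square)
  have "transpose (X + s *\<^sub>R H) ** (X + s *\<^sub>R H) - mat 1 = (?T - mat 1) + s *\<^sub>R 0 + s\<^sup>2 *\<^sub>R ?Q"
    by (simp add: transpose_expand matrix_expand XH HX power2_eq_square)
  then have gram: "(norm (transpose (X + s *\<^sub>R H) ** (X + s *\<^sub>R H) - mat 1))\<^sup>2
      = (norm (?T - mat 1))\<^sup>2 + s\<^sup>2 * (2 * ((?T - mat 1) \<bullet> ?Q)) + s ^ 4 * (norm ?Q)\<^sup>2"
    by (simp only: norm_add_scaled_pair_square) simp
  have "(?T - mat 1) \<bullet> ?Q = (H ** (?T - mat 1)) \<bullet> H"
    by (simp add: inner_matrix_mult_left)
  also have "\<dots> = (\<theta> - 1) * (H \<bullet> H)"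
    by (simp add: matrix_diff_ldistrib HT inner_diff_left algebra_simps)
  finally have TQ: "(?T - mat 1) \<bullet> ?Q = (\<theta> - 1) * (H \<bullet> H)" .
  show ?thesis
    unfolding penalty_fun_commuting[OF comm] penalty_fun_commuting[OF JX] quad gram TQ
    by (simp add: power2_norm_eq_inner[of H] field_simps)
qed

lemma not_eventually_nonneg_neg_quadratic:
  fixes b e :: real
  assumes "b < 0"
  shows "\<not> (\<forall>\<^sub>F s in nhds 0. 0 \<le> s\<^sup>2 * b + s ^ 4 * e)"
proof
  assume "\<forall>\<^sub>F s in nhds 0. 0 \<le> s\<^sup>2 * b + s ^ 4 * e"
  then have "\<forall>\<^sub>F s in at 0. 0 \<le> s\<^sup>2 * b + s ^ 4 * e"
    by (simp add: eventually_at_filter) (auto elim: eventually_mono)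
  moreover have "\<forall>\<^sub>F s in at (0::real). s \<noteq> 0"
    by (simp add: eventually_at_filter)
  ultimately have "\<forall>\<^sub>F s in at 0. 0 \<le> b + s\<^sup>2 * e"
  proof eventually_elim
    case (elim s)
    then have "0 \<le> s\<^sup>2 * (b + s\<^sup>2 * e)" by (simp add: algebra_simps power4_eq_xxxx power2_eq_square)
    then show ?case using elim(2) by (simp add: zero_le_mult_iff)
  qed
  moreover have "((\<lambda>s. b + s\<^sup>2 * e) \<longlongrightarrow> b + 0\<^sup>2 * e) (at 0)"
    by (intro tendsto_intros)
  ultimately have "0 \<le> b + 0\<^sup>2 * e"
    by (intro tendsto_lowerbound) auto
  then show False using assms by simp
qed

text \<open>
  The descent direction: \<open>u = e\<^sub>i - X X\<^sup>T e\<^sub>i / r\<^sub>i\<close> is the part of the unit vector \<open>e\<^sub>i\<close> orthogonal to the columns of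
  \<open>X\<close>. It stays in the \<open>r\<^sub>i\<close>-eigenspace of \<open>R\<close> because \<open>X X\<^sup>T\<close> commutes with \<open>R\<close>, and its \<open>i\<close>-th entry is
  \<open>1 - s\<^sub>i\<close>, so it is nonzero when row \<open>i\<close> is not full. Moving weight from \<open>v\<close> to \<open>u\<close> lowers the penalty function.
\<close>

lemma local_minimizer_row_weight_full:
  fixes X :: "real^('p::finite + 'p)^('n::finite + 'n)"
  assumes \<beta>: "\<beta> > 0" and JX: "J ** X = X ** J"
    and crit: "X ** transpose X ** X = diag (row_target \<beta> e) ** X"
    and locmin: "local_minimizer (penalty_fun (double_diag e) \<beta>) X"
    and v: "v \<noteq> 0" "v v* (transpose X ** X) = \<theta> *\<^sub>R v"
    and i: "row_target \<beta> e i > \<theta>" "row_target \<beta> e i > 0"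
  shows "row_weight (row_target \<beta> e) X i = 1"
proof (rule ccontr)
  assume not_full: "row_weight (row_target \<beta> e) X i \<noteq> 1"
  let ?r = "row_target \<beta> e" and ?K = "X ** transpose X" and ?T = "transpose X ** X"
  define u where "u = axis i 1 - (1 / ?r i) *\<^sub>R (?K *v axis i 1)"
  have K_axis: "(?K *v axis i 1) $ j = X $ j \<bullet> X $ i" for j
    by (simp add: matrix_vector_mul_component inner_axis gram_entry)
  have u_component: "u $ j = (if j = i then 1 else 0) - (X $ j \<bullet> X $ i) / ?r i" for j
    by (simp add: u_def K_axis) (simp add: axis_def)
  have "u $ i = 1 - row_weight ?r X i"
    by (simp add: u_component row_weight_def power2_norm_eq_inner)
  then have "u \<noteq> 0" using not_full by auto
  have "transpose X *v (?K *v axis i 1) = ?r i *\<^sub>R (transpose X *v axis i 1)"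
  proof -
    have "transpose X *v (?K *v axis i 1) = (transpose X *v axis i 1) v* ?T"
    proof -
      have "transpose X *v (?K *v axis i 1) = ?T *v (transpose X *v axis i 1)"
        by (simp only: matrix_vector_mul_assoc matrix_mul_assoc)
      moreover have "transpose ?T = ?T" by (simp add: matrix_transpose_mul)
      ultimately show ?thesis by (metis transpose_matrix_vector)
    qed
    moreover have "transpose X *v axis i 1 = X $ i"
      by (simp add: vec_eq_iff vector_matrix_mult_def axis_def if_distrib[of "\<lambda>x. x * _"] cong: if_cong)
    ultimately show ?thesis using row_eigenvector[OF crit, of i] by simp
  qed
  then have Xu: "transpose X *v u = 0"
    using i(2) by (simp add: u_def matrix_vector_mult_diff_distrib matrix_vector_mult_scaleR del: transpose_matrix_vector)
  have Ru: "diag ?r *v u = ?r i *\<^sub>R u"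
  proof -
    have "?r j * u $ j = ?r i * u $ j" for j
      using gram_commutes[OF crit, of j i] by (auto simp: u_component algebra_simps)
    moreover have "(diag ?r *v u) $ j = ?r j * u $ j" for j
      by (simp add: matrix_vector_mult_def diag_def if_distrib[of "\<lambda>x. x * _"] cong: if_cong)
    ultimately show ?thesis by (simp add: vec_eq_iff)
  qed
  \<comment> \<open>Twice the projection of \<open>u v\<^sup>T\<close> onto the matrices commuting with \<open>J\<close>. Since \<open>X\<close>, \<open>R\<close> and \<open>T\<close> are
    compatible with \<open>J\<close>, the projection keeps all relations satisfied by \<open>u v\<^sup>T\<close>.\<close>
  define H0 where "H0 = outer u v"
  define H where "H = H0 - J ** H0 ** J"
  have XH0: "transpose X ** H0 = 0"
    by (simp add: H0_def matrix_mult_outer Xu outer_zero del: transpose_matrix_vector)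
  have RH0: "diag ?r ** H0 = ?r i *\<^sub>R H0"
    by (simp add: H0_def matrix_mult_outer Ru outer_scale)
  have H0T: "H0 ** ?T = \<theta> *\<^sub>R H0"
    by (simp add: H0_def outer_matrix_mult v(2) outer_scale)
  have XtJ: "transpose X ** J = J ** transpose X"
    using arg_cong[OF JX, of transpose] by (simp add: transpose_expand transpose_J matrix_expand)
  have TJ: "J ** ?T = ?T ** J"
    by (simp only: matrix_mul_assoc XtJ[symmetric]) (simp only: matrix_mul_assoc[symmetric] JX)
  have RJ: "diag ?r ** J = J ** diag ?r"
  proof -
    have "?r = case_sum (\<lambda>a. 1 - e a / \<beta>) (\<lambda>a. 1 - e a / \<beta>)"
      by (auto simp: row_target_def split: sum.split)
    then show ?thesis using J_diag[of "\<lambda>a. 1 - e a / \<beta>"] by simp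
  qed
  have JH: "J ** H = H ** J"
    by (simp add: H_def matrix_expand J_J_mult J_J)
  have XH: "transpose X ** H = 0"
  proof -
    have "transpose X ** (J ** H0 ** J) = J ** (transpose X ** H0) ** J"
      by (simp only: matrix_mul_assoc XtJ)
    then show ?thesis by (simp add: H_def matrix_diff_ldistrib XH0)
  qed
  have RH: "diag ?r ** H = ?r i *\<^sub>R H"
  proof -
    have "diag ?r ** (J ** H0 ** J) = J ** (diag ?r ** H0) ** J"
      by (simp only: matrix_mul_assoc RJ)
    then show ?thesis by (simp add: H_def matrix_diff_ldistrib RH0 matrix_scale_left matrix_scale_right scaleR_diff_right)
  qed
  have HT: "H ** ?T = \<theta> *\<^sub>R H"
  proof -
    have "J ** H0 ** J ** ?T = J ** (H0 ** ?T) ** J"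
      by (simp only: matrix_mul_assoc[symmetric] TJ[unfolded matrix_mul_assoc[symmetric]])
    then show ?thesis by (simp add: H_def matrix_diff_rdistrib H0T matrix_scale_left matrix_scale_right scaleR_diff_right)
  qed
  \<comment> \<open>The projection does not kill \<open>u v\<^sup>T\<close>, because \<open>v\<close> and \<open>J v\<close> are orthogonal.\<close>
  have "H *v v = (v \<bullet> v) *\<^sub>R u"
    by (simp add: H_def H0_def matrix_vector_mult_diff_rdistrib outer_mult_vec J_isotropic matrix_mult_outer
        flip: matrix_vector_mul_assoc)
  then have "H *v v \<noteq> 0" using v(1) \<open>u \<noteq> 0\<close> by simp
  then have "H \<noteq> 0" by auto
  then have neg: "\<beta>/2 * (\<theta> - ?r i) * (norm H)\<^sup>2 < 0"
    using \<beta> i(1) by (simp add: mult_pos_neg mult_neg_pos)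
  have line: "penalty_fun (double_diag e) \<beta> (X + s *\<^sub>R H) = penalty_fun (double_diag e) \<beta> X
    + s\<^sup>2 * (\<beta>/2 * (\<theta> - ?r i) * (norm H)\<^sup>2) + s ^ 4 * (\<beta>/4 * (norm (transpose H ** H))\<^sup>2)" for s
    using penalty_fun_along_eigendirection[OF _ JX JH XH RH HT, of s] \<beta> by simp
  show False
    using not_eventually_nonneg_neg_quadratic[OF neg, of "\<beta>/4 * (norm (transpose H ** H))\<^sup>2"]
      local_minimizer_on_line[OF locmin, of H] unfolding line by (simp add: add.assoc)
qed

section \<open>Local minimisers are global\<close>

text \<open>
  The threshold is \<open>\<theta> = 0\<close> with \<open>v\<close> in the kernel of \<open>X\<close> if the rows do not span; otherwise the constraint on the sum
  of the weights is tight and \<open>\<theta>\<close> is the smallest \<open>r\<^sub>k\<close> belonging to a nonzero row \<open>k\<close>, with that row as \<open>v\<close>.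
\<close>

lemma local_minimizer_norm_gram_maximal:
  fixes X Z :: "real^('p::finite + 'p)^('n::finite + 'n)"
  assumes \<beta>: "\<beta> > 0" and JX: "J ** X = X ** J"
    and X: "X ** transpose X ** X = diag (row_target \<beta> e) ** X"
    and locmin: "local_minimizer (penalty_fun (double_diag e) \<beta>) X"
    and Z: "Z ** transpose Z ** Z = diag (row_target \<beta> e) ** Z"
  shows "norm (transpose Z ** Z) \<le> norm (transpose X ** X)"
proof -
  let ?r = "row_target \<beta> e"
  have full: "row_weight ?r X i = 1"
    if "v \<noteq> 0" "v v* (transpose X ** X) = \<theta> *\<^sub>R v" "?r i > \<theta>" "\<theta> \<ge> 0" for v \<theta> i
    using local_minimizer_row_weight_full[OF \<beta> JX X locmin that(1,2)] that(3,4)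
    by simp
  show ?thesis
  proof (cases "row_projection ?r X = mat 1")
    case True
    then have total: "(\<Sum>i\<in>UNIV. row_weight ?r X i) = real CARD('p + 'p)"
      using sum_row_weight[OF X] by simp
    define I where "I = {i. X $ i \<noteq> 0}"
    have "I \<noteq> {}"
    proof
      assume "I = {}"
      then have "row_weight ?r X i = 0" for i by (auto simp: I_def row_weight_def)
      then show False using total by simp
    qed
    then obtain k where k: "k \<in> I" and k_min: "\<And>i. i \<in> I \<Longrightarrow> ?r k \<le> ?r i"
      using ex_min_if_finite[of "?r ` I"] by (fastforce simp: not_less)
    have "?r k > 0"
      using k row_zero_if_nonpos[OF X, of k] by (force simp: I_def)
    show ?thesis
    proof (rule gram_norm_optimal[OF X Z, of "?r k"])
      show "row_weight ?r X i = 1" if "?r i > ?r k" for i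
        using full[of "X $ k"] row_eigenvector[OF X] k that \<open>?r k > 0\<close> by (simp add: I_def)
      show "row_weight ?r X i = 0" if "?r i < ?r k" for i
        using k_min[of i] that by (auto simp: I_def row_weight_def)
    qed (use \<open>?r k > 0\<close> total in auto)
  next
    case False
    then obtain w where "(mat 1 - row_projection ?r X) *v w \<noteq> 0"
      using matrix_eq[of "mat 1 - row_projection ?r X" 0] by auto
    moreover define v where "v = (mat 1 - row_projection ?r X) *v w"
    ultimately have "v \<noteq> 0" by simp
    have "X *v v = (X ** (mat 1 - row_projection ?r X)) *v w"
      by (simp add: v_def matrix_vector_mul_assoc)
    then have "X *v v = 0"
      by (simp add: matrix_diff_ldistrib row_projection_fixes[OF X])
    then have "v v* (transpose X ** X) = 0 *\<^sub>R v"
      by (simp flip: vector_matrix_mul_assoc)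
    show ?thesis
    proof (rule gram_norm_optimal[OF X Z, of 0])
      show "row_weight ?r X i = 1" if "?r i > 0" for i
        using full[OF \<open>v \<noteq> 0\<close> \<open>v v* (transpose X ** X) = 0 *\<^sub>R v\<close> that] by simp
      show "row_weight ?r X i = 0" if "?r i < 0" for i
        using row_weight_eq_0[OF X] that by simp
    qed auto
  qed
qed

text \<open>
  The quadratic term alone makes the penalty function coercive, because \<open>double_diag e\<close> is bounded below by
  the smallest \<open>e\<close>.
\<close>

lemma penalty_fun_attains_min:
  fixes e :: "'n::finite \<Rightarrow> real"
  assumes e: "\<And>a. e a > 0" and \<beta>: "\<beta> > 0"
  obtains Z :: "real^('p::finite + 'p)^('n + 'n)"
  where "global_minimizer (penalty_fun (double_diag e) \<beta>) Z"
proof -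
  let ?f = "penalty_fun (double_diag e) \<beta> :: real^('p + 'p)^('n + 'n) \<Rightarrow> real"
  define m where "m = Min (range (case_sum e e))"
  have m_le: "m \<le> case_sum e e i" for i
    by (simp add: m_def)
  have "m > 0"
    using e by (auto simp: m_def split: sum.split)
  have coercive: "m / 2 * (norm Y)\<^sup>2 \<le> ?f Y" for Y
  proof -
    have "m * (norm Y)\<^sup>2 = (\<Sum>i\<in>UNIV. m * (norm (Y $ i))\<^sup>2)"
      by (simp only: power2_norm_eq_inner sum_distrib_left[symmetric] inner_vec_def[of Y])
    also have "\<dots> \<le> Y \<bullet> (double_diag e ** Y)"
      unfolding double_diag_eq inner_diag_mult by (intro sum_mono mult_right_mono m_le) simp
    finally show ?thesis
      using \<beta> by (simp add: penalty_fun_eq add_increasing2)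
  qed
  have "?f 0 \<ge> 0" using coercive[of 0] by simp
  define \<rho> where "\<rho> = sqrt (2 * ?f 0 / m)"
  have "\<rho> \<ge> 0" and \<rho>_sq: "\<rho>\<^sup>2 = 2 * ?f 0 / m"
    using \<open>m > 0\<close> \<open>?f 0 \<ge> 0\<close> by (simp_all add: \<rho>_def divide_nonneg_pos)
  then have "\<exists>Z\<in>cball 0 \<rho>. \<forall>Y\<in>cball 0 \<rho>. ?f Z \<le> ?f Y"
    by (intro continuous_attains_inf continuous_on_penalty_fun) auto
  then obtain Z where Z: "\<And>Y. Y \<in> cball 0 \<rho> \<Longrightarrow> ?f Z \<le> ?f Y" by blast
  have "?f Z \<le> ?f Y" for Y
  proof (cases "Y \<in> cball 0 \<rho>")
    case False
    then have "\<rho>\<^sup>2 < (norm Y)\<^sup>2"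
      using \<open>\<rho> \<ge> 0\<close> by (intro power_strict_mono) auto
    then have "?f 0 < m / 2 * (norm Y)\<^sup>2"
      unfolding \<rho>_sq using \<open>m > 0\<close> by (simp add: field_simps)
    moreover have "?f Z \<le> ?f 0"
      using \<open>\<rho> \<ge> 0\<close> by (intro Z) simp
    ultimately show ?thesis using coercive[of Y] by linarith
  qed (rule Z)
  then show ?thesis using that by (auto simp: global_minimizer_def)
qed

lemma global_imp_local_minimizer: "global_minimizer f Z \<Longrightarrow> local_minimizer f Z"
  by (simp add: global_minimizer_def local_minimizer_def)

text \<open>
  Rather than computing the infimum, compare with a global minimiser \<open>Z\<close>: it satisfies the same critical point
  equations, so the values at \<open>X\<close> and \<open>Z\<close> differ only through the norms of the Gram matrices.
\<close>

lemma local_minimizer_global_double_diag: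
  fixes X :: "real^('p::finite + 'p)^('n::finite + 'n)"
  assumes e: "\<And>a. e a > 0" and \<beta>: "\<beta> > 0"
    and locmin: "local_minimizer (penalty_fun (double_diag e) \<beta>) X"
  shows "global_minimizer (penalty_fun (double_diag e) \<beta>) X"
proof -
  obtain Z :: "real^('p + 'p)^('n + 'n)" where Z: "global_minimizer (penalty_fun (double_diag e) \<beta>) Z"
    using penalty_fun_attains_min[OF e \<beta>] .
  have sym: "transpose (double_diag e) = double_diag e"
    by (simp add: double_diag_eq transpose_diag)
  note X_struct = critical_point_structure[OF e \<beta> local_minimizer_imp_critical[OF sym locmin]]
  note Z_struct = critical_point_structure[OF e \<beta>
      local_minimizer_imp_critical[OF sym global_imp_local_minimizer[OF Z]]]
  have "norm (transpose Z ** Z) \<le> norm (transpose X ** X)"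
    by (rule local_minimizer_norm_gram_maximal[OF \<beta> X_struct locmin Z_struct(2)])
  then have "(norm (transpose Z ** Z))\<^sup>2 \<le> (norm (transpose X ** X))\<^sup>2"
    by (simp add: power_mono)
  then have "\<beta>/4 * (real CARD('p + 'p) - (norm (transpose X ** X))\<^sup>2)
      \<le> \<beta>/4 * (real CARD('p + 'p) - (norm (transpose Z ** Z))\<^sup>2)"
    using \<beta> by (intro mult_left_mono) simp_all
  moreover have "\<beta> \<noteq> 0" using \<beta> by simp
  note penalty_fun_critical_value[OF this X_struct] penalty_fun_critical_value[OF this Z_struct]
  ultimately have "penalty_fun (double_diag e) \<beta> X \<le> penalty_fun (double_diag e) \<beta> Z"
    by (simp only:)
  then show ?thesis
    using Z unfolding global_minimizer_def by (meson order_trans)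
qed

lemma symplectic_eigenvaluesE:
  fixes A :: "real^('n::finite + 'n)^('n + 'n)"
  assumes "symplectic_eigenvalues A d"
  obtains S :: "real^('n + 'n)^('n + 'n)" and e :: "'n \<Rightarrow> real"
  where "transpose S ** J ** S = J" "transpose S ** A ** S = double_diag e" "\<And>a. e a > 0"
proof -
  obtain S \<nu> where "bij_betw \<nu> (UNIV :: 'n set) {1..CARD('n)}"
    and S: "transpose S ** J ** S = J" "transpose S ** A ** S = double_diag (\<lambda>a. d (\<nu> a))"
    and "\<forall>j\<in>{1..CARD('n)}. 0 < d j"
    using assms by (auto simp: symplectic_eigenvalues_def)
  then have "d (\<nu> a) > 0" for a
    using bij_betwE by blast
  with S show ?thesis by (rule that)
qed

lemma local_minimizer_compose:
  assumes "local_minimizer f (g y)" and "isCont g y"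
  shows "local_minimizer (\<lambda>y. f (g y)) y"
proof -
  have "filterlim g (nhds (g y)) (nhds y)"
    using assms(2) by (simp add: isCont_def tendsto_at_iff_tendsto_nhds)
  then show ?thesis
    using assms(1) unfolding local_minimizer_def filterlim_iff by blast
qed

lemma local_minimizer_global:
  fixes A :: "real^('n::finite + 'n)^('n + 'n)" and X :: "real^('p::finite + 'p)^('n + 'n)"
  assumes "symplectic_eigenvalues A d" and "\<beta> > 0"
    and locmin: "local_minimizer (penalty_fun A \<beta>) X"
  shows "global_minimizer (penalty_fun A \<beta>) X"
proof -
  obtain S :: "real^('n + 'n)^('n + 'n)" and e :: "'n \<Rightarrow> real"
    where S: "transpose S ** J ** S = J" and SAS: "transpose S ** A ** S = double_diag e"
    and e: "\<And>a. e a > 0"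
    by (rule symplectic_eigenvaluesE[OF assms(1)]) blast
  obtain S' where SS': "S ** S' = mat 1"
    using symplectic_has_inverse[OF S] .
  have change: "penalty_fun A \<beta> (S ** Y) = penalty_fun (double_diag e) \<beta> Y" for Y :: "real^('p + 'p)^('n + 'n)"
    by (simp add: penalty_fun_symplectic[OF S] SAS)
  have S_S': "S ** (S' ** Y) = Y" for Y :: "real^('p + 'p)^('n + 'n)"
    by (simp add: matrix_mul_assoc SS')
  have "isCont (\<lambda>Y. S ** Y) (S' ** X)"
    by (intro bounded_linear.isCont[OF bounded_bilinear.bounded_linear_right[OF bounded_bilinear_matrix_mult]] continuous_ident)
  then have "local_minimizer (\<lambda>Y. penalty_fun A \<beta> (S ** Y)) (S' ** X)"
    using locmin by (simp add: S_S' local_minimizer_compose[where f = "penalty_fun A \<beta>"])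
  then have "local_minimizer (penalty_fun (double_diag e) \<beta>) (S' ** X)"
    by (simp add: change)
  then have "global_minimizer (penalty_fun (double_diag e) \<beta>) (S' ** X)"
    by (rule local_minimizer_global_double_diag[OF e \<open>\<beta> > 0\<close>])
  moreover have "penalty_fun A \<beta> Y = penalty_fun (double_diag e) \<beta> (S' ** Y)" for Y :: "real^('p + 'p)^('n + 'n)"
    using change[of "S' ** Y"] by (simp only: S_S')
  ultimately show ?thesis
    unfolding global_minimizer_def by simp
qed

theorem theorem7:
  fixes A :: "real^('n::finite + 'n)^('n + 'n)"
    and d :: "nat \<Rightarrow> real"
    and \<beta> :: real
  assumes "CARD('p::finite) \<le> CARD('n)"
    and "sym_pos_def A"
    and "symplectic_eigenvalues A d"
    and "\<beta> > d CARD('p)"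
  shows "(\<forall>X :: real^('p + 'p)^('n + 'n).
            local_minimizer (penalty_fun A \<beta>) X \<longrightarrow> global_minimizer (penalty_fun A \<beta>) X) \<and>
         (\<forall>X :: real^('p + 'p)^('n + 'n).
            stationary_point (penalty_fun A \<beta>) X \<longrightarrow>
              global_minimizer (penalty_fun A \<beta>) X \<or>
              saddle_point (penalty_fun A \<beta>) X \<or>
              local_maximizer (penalty_fun A \<beta>) X)"
proof -
  have "0 < d CARD('p)"
    using assms(1,3) by (simp add: symplectic_eigenvalues_def Suc_le_eq)
  then have "\<beta> > 0" using assms(4) by linarith
  then have "local_minimizer (penalty_fun A \<beta>) X \<Longrightarrow> global_minimizer (penalty_fun A \<beta>) X"
    for X :: "real^('p + 'p)^('n + 'n)"
    by (rule local_minimizer_global[OF assms(3)])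
  then show ?thesis
    unfolding saddle_point_def by blast
qed

end
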